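(* Let $\epsilon\in(0,1)$. There exist a function $\gamma_\epsilon:\mathbb{N}\to\mathbb{R}$ and a constant $C_\epsilon>0$ such that $|\gamma_\epsilon(n)|\le C_\epsilon/n$ for all $n$ (in particular $\gamma_\epsilon(n)\to0$ as $n\to\infty$) and \[\alpha_{n,\epsilon n} = \binom{n}{\epsilon n-1}\bigl(1-\gamma_\epsilon(n)\bigr)\] for all $n\in\mathbb{N}$ such that $\epsilon n$ is an integer.
   Context: $\mathcal{P}_{\mathrm{fin},0}(\mathbb{N}_0)$ is the monoid of finite subsets of $\mathbb{N}_0$ containing $0$ under sumset $A+B=\{a+b: a\in A, b\in B\}$, with identity $\{0\}$. An atom is an element $A\ne\{0\}$ such that $A=B+C$ with $B,C\in\mathcal{P}_{\mathrm{fin},0}(\mathbb{N}_0)$ implies $B=\{0\}$ or $C=\{0\}$; let $\mathcal{A}$ be the set of atoms. For $n,k\in\mathbb{N}$, $\mathcal{A}_{n,k}=\{A\in\mathcal{A} : \max A\le n,\ |A|=k\}$ and $\alpha_{n,k}=|\mathcal{A}_{n,k}|$. *)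

theory Defs
  imports Complex_Main "HOL-Library.Set_Algebras"
begin

text \<open>The sumset is the operation \<open>+\<close> on sets from \<open>HOL-Library.Set_Algebras\<close>.\<close>

definition Pfin0 :: "nat set set" where
  "Pfin0 = {A. finite A \<and> 0 \<in> A}"

lemma Pfin0_identity: "{0} \<in> Pfin0"
  by (simp add: Pfin0_def)

lemma Pfin0_sumset: "A \<in> Pfin0 \<Longrightarrow> B \<in> Pfin0 \<Longrightarrow> A + B \<in> Pfin0"
  using set_plus_intro[of 0 A 0 B] by (auto simp: Pfin0_def finite_set_plus)

definition atoms :: "nat set set" where
  "atoms = {A \<in> Pfin0. A \<noteq> {0} \<and>
     (\<forall>B\<in>Pfin0. \<forall>C\<in>Pfin0. A = B + C \<longrightarrow> B = {0} \<or> C = {0})}"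

definition atoms_nk :: "nat \<Rightarrow> nat \<Rightarrow> nat set set" where
  "atoms_nk n k = {A \<in> atoms. Max A \<le> n \<and> card A = k}"

lemma finite_atoms_nk: "finite (atoms_nk n k)"
  by (rule finite_subset[of _ "Pow {..n}"])
     (auto simp: atoms_nk_def atoms_def Pfin0_def intro: order_trans[OF Max_ge])

definition alpha :: "nat \<Rightarrow> nat \<Rightarrow> nat" where
  "alpha n k = card (atoms_nk n k)"

end

theory Submission
  imports Defs "HOL-Real_Asymp.Real_Asymp"
begin

text \<open>
  Choose a random subset of \<open>{0..n}\<close> by including every element independently with probability
  \<open>\<epsilon>\<close>. It has exactly \<open>\<epsilon>n\<close> elements with probability of order at least \<open>1/n\<close>, so it suffices that
  a random set is a nontrivial sumset \<open>B + C\<close> with super-polynomially small probability.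
  Let \<open>t\<close> be about \<open>n\<^sup>1\<^sup>/\<^sup>7\<close> and \<open>|B| \<le> |C|\<close>. Since \<open>|B| |C| \<ge> \<epsilon>n \<ge> t\<^sup>6\<close>, we have \<open>|C| \<ge> t\<^sup>3\<close>.

  If \<open>|B| \<ge> t\<close>, a greedy choice gives \<open>t\<close>-element subsets of \<open>B\<close> and \<open>C\<close> all of whose \<open>t\<^sup>2\<close> sums are
  distinct and lie in the random set. For given subsets this has probability \<open>\<epsilon>\<close> to the power
  \<open>t\<^sup>2\<close>, which beats the \<open>(n+1)\<^sup>2\<^sup>t\<close> choices.

  If \<open>|B| < t\<close>, the random set is a union of translates of \<open>B\<close>. At a given position this fails with
  probability bounded below independently of \<open>B\<close>, and positions with disjoint windows are independent.
  There are \<open>t\<^sup>3\<close> such positions, which beats the \<open>t(n+1)\<^sup>t\<close> choices of \<open>B\<close>.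
\<close>

section \<open>Bernoulli weights\<close>

text \<open>The probability that a random subset of \<open>U\<close>, containing each element
  independently with probability \<open>p\<close>, lies in \<open>F\<close>. Cutting
  \<open>F\<close> down to \<open>Pow U\<close> lets events be written without mentioning
  \<open>U\<close>.\<close>

definition bernoulli_weight :: "real \<Rightarrow> 'a set \<Rightarrow> 'a set set \<Rightarrow> real" where
  "bernoulli_weight p U F = (\<Sum>A\<in>F \<inter> Pow U. p ^ card A * (1 - p) ^ card (U - A))"

lemma bernoulli_weight_nonneg:
  assumes "0 \<le> p" "p \<le> 1"
  shows "0 \<le> bernoulli_weight p U F"
  unfolding bernoulli_weight_def using assms by (intro sum_nonneg) auto

lemma bernoulli_weight_mono:
  assumes "finite U" "0 \<le> p" "p \<le> 1" "F \<inter> Pow U \<subseteq> G"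
  shows "bernoulli_weight p U F \<le> bernoulli_weight p U G"
  unfolding bernoulli_weight_def using assms by (intro sum_mono2) auto

lemma bernoulli_weight_UNIV:
  assumes "finite U"
  shows "bernoulli_weight p U UNIV = 1"
  using prod_add[OF assms, of "\<lambda>_. p" "\<lambda>_. 1 - p"] by (simp add: bernoulli_weight_def)

lemma bernoulli_weight_Compl:
  assumes "finite U"
  shows "bernoulli_weight p U (- F) = 1 - bernoulli_weight p U F"
proof -
  let ?w = "\<lambda>A. p ^ card A * (1 - p) ^ card (U - A)"
  have "sum ?w (F \<inter> Pow U) + sum ?w (- F \<inter> Pow U) = sum ?w ((F \<inter> Pow U) \<union> (- F \<inter> Pow U))"
    using assms by (intro sum.union_disjoint[symmetric]) auto
  also have "(F \<inter> Pow U) \<union> (- F \<inter> Pow U) = UNIV \<inter> Pow U"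
    by auto
  finally show ?thesis
    using bernoulli_weight_UNIV[OF assms, of p] by (simp add: bernoulli_weight_def)
qed

lemma bernoulli_weight_Un_le:
  assumes "finite U" "0 \<le> p" "p \<le> 1"
  shows "bernoulli_weight p U (F \<union> G) \<le> bernoulli_weight p U F + bernoulli_weight p U G"
proof -
  have "(F \<union> G) \<inter> Pow U = (F \<inter> Pow U) \<union> (G \<inter> Pow U)"
    by auto
  then show ?thesis
    unfolding bernoulli_weight_def using assms
    by (auto simp: sum_Un intro!: sum_nonneg)
qed

lemma bernoulli_weight_UN_le:
  assumes "finite U" "0 \<le> p" "p \<le> 1" "finite I"
  shows "bernoulli_weight p U (\<Union>i\<in>I. F i) \<le> (\<Sum>i\<in>I. bernoulli_weight p U (F i))"
  using assms(4)
proof (induction I rule: finite_induct)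
  case empty
  then show ?case by (simp add: bernoulli_weight_def)
next
  case (insert i I)
  then show ?case
    using bernoulli_weight_Un_le[OF assms(1-3), of "F i" "\<Union>i\<in>I. F i"] by simp
qed

lemma bernoulli_weight_UN_le_const:
  assumes "finite U" "0 \<le> p" "p \<le> 1" "finite I"
    and "\<And>i. i \<in> I \<Longrightarrow> bernoulli_weight p U (F i) \<le> c" and "real (card I) \<le> N" and "0 \<le> c"
  shows "bernoulli_weight p U (\<Union>i\<in>I. F i) \<le> N * c"
proof -
  have "bernoulli_weight p U (\<Union>i\<in>I. F i) \<le> real (card I) * c"
    using bernoulli_weight_UN_le[OF assms(1-4), of F] sum_bounded_above[of I _ c] assms(5)
    by (meson order_trans)
  then show ?thesis
    using assms(6,7) by (meson mult_right_mono order_trans)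
qed

text \<open>Sending \<open>A\<close> to \<open>(A \<inter> U, A \<inter> V)\<close> is a bijection
  onto pairs of subsets, and weights multiply along it, so traces on disjoint sets are
  independent.\<close>

lemma bernoulli_weight_disjoint_Un:
  assumes "finite U" "finite V" "U \<inter> V = {}"
  shows "bernoulli_weight p (U \<union> V) {A. A \<inter> U \<in> F \<and> A \<inter> V \<in> G} =
    bernoulli_weight p U F * bernoulli_weight p V G"
proof -
  let ?w = "\<lambda>U A. p ^ card A * (1 - p) ^ card (U - A)"
  have w: "?w (U \<union> V) (X \<union> Y) = ?w U X * ?w V Y" if "X \<subseteq> U" "Y \<subseteq> V" for X Y
  proof -
    have "finite X" "finite Y" and disj: "X \<inter> Y = {}" "(U - X) \<inter> (V - Y) = {}"
      and eq: "U \<union> V - (X \<union> Y) = (U - X) \<union> (V - Y)"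
      using that assms by (auto intro: finite_subset)
    then have "card (X \<union> Y) = card X + card Y"
      "card (U \<union> V - (X \<union> Y)) = card (U - X) + card (V - Y)"
      unfolding eq using assms by (simp_all add: card_Un_disjoint)
    then show ?thesis
      by (simp add: power_add)
  qed
  have "bernoulli_weight p U F * bernoulli_weight p V G =
      (\<Sum>(X, Y)\<in>(F \<inter> Pow U) \<times> (G \<inter> Pow V). ?w U X * ?w V Y)"
    by (simp add: bernoulli_weight_def sum_product sum.cartesian_product)
  also have "\<dots> = bernoulli_weight p (U \<union> V) {A. A \<inter> U \<in> F \<and> A \<inter> V \<in> G}"
    unfolding bernoulli_weight_def
  proof (rule sum.reindex_bij_witness[where j = "\<lambda>(X, Y). X \<union> Y" and i = "\<lambda>A. (A \<inter> U, A \<inter> V)"], goal_cases)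
    case (1 a)
    then show ?case using assms(3) by auto
  next
    case (2 a)
    then obtain X Y where XY: "a = (X, Y)" "X \<in> F" "Y \<in> G" "X \<subseteq> U" "Y \<subseteq> V"
      by auto
    then have "(X \<union> Y) \<inter> U = X" "(X \<union> Y) \<inter> V = Y"
      using assms(3) by auto
    then show ?case using XY by auto
  next
    case (3 b)
    then show ?case by auto
  next
    case (4 b)
    then show ?case by auto
  next
    case (5 a)
    then show ?case by (auto simp: w)
  qed
  finally show ?thesis by simp
qed

lemma bernoulli_weight_independent:
  assumes "finite I" "finite U" "\<And>i. i \<in> I \<Longrightarrow> X i \<subseteq> U"
    and "\<And>i j. i \<in> I \<Longrightarrow> j \<in> I \<Longrightarrow> i \<noteq> j \<Longrightarrow> X i \<inter> X j = {}"
  shows "bernoulli_weight p U {A. \<forall>i\<in>I. A \<inter> X i \<in> G i} = (\<Prod>i\<in>I. bernoulli_weight p (X i) (G i))"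
  using assms
proof (induction I arbitrary: U rule: finite_induct)
  case empty
  then show ?case by (simp add: bernoulli_weight_UNIV)
next
  case (insert i I)
  let ?V = "U - X i"
  have sub: "X j \<subseteq> ?V" if "j \<in> I" for j
    using insert.prems(2)[of j] insert.prems(3)[of i j] insert.hyps that by auto
  have U: "X i \<union> ?V = U" and fin: "finite (X i)" "finite ?V"
    using insert.prems(1) insert.prems(2)[of i] by (auto intro: finite_subset)
  have "A \<inter> ?V \<inter> X j = A \<inter> X j" if "j \<in> I" for j A
    using sub[OF that] by auto
  then have eq: "{A. \<forall>j\<in>insert i I. A \<inter> X j \<in> G j} =
      {A. A \<inter> X i \<in> G i \<and> A \<inter> ?V \<in> {A. \<forall>j\<in>I. A \<inter> X j \<in> G j}}"
    by auto
  have "bernoulli_weight p U {A. \<forall>j\<in>insert i I. A \<inter> X j \<in> G j} =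
      bernoulli_weight p (X i) (G i) * bernoulli_weight p ?V {A. \<forall>j\<in>I. A \<inter> X j \<in> G j}"
    unfolding eq using bernoulli_weight_disjoint_Un[OF fin, of p "G i"]
    unfolding U by blast
  also have "bernoulli_weight p ?V {A. \<forall>j\<in>I. A \<inter> X j \<in> G j} =
      (\<Prod>j\<in>I. bernoulli_weight p (X j) (G j))"
    using sub fin insert.prems by (intro insert.IH) auto
  finally show ?case
    using insert.hyps by simp
qed

lemma bernoulli_weight_superset:
  assumes "finite U" "S \<subseteq> U"
  shows "bernoulli_weight p U {A. S \<subseteq> A} = p ^ card S"
proof -
  have "finite S"
    using assms finite_subset by blast
  have "bernoulli_weight p (S \<union> (U - S)) {A. A \<inter> S \<in> {S} \<and> A \<inter> (U - S) \<in> UNIV} =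
      bernoulli_weight p S {S} * bernoulli_weight p (U - S) UNIV"
    using assms \<open>finite S\<close> by (intro bernoulli_weight_disjoint_Un) auto
  also have "\<dots> = p ^ card S"
    using assms by (simp add: bernoulli_weight_UNIV) (simp add: bernoulli_weight_def)
  also have "{A. A \<inter> S \<in> {S} \<and> A \<inter> (U - S) \<in> UNIV} = {A. S \<subseteq> A}"
    by auto
  also have "S \<union> (U - S) = U"
    using assms by auto
  finally show ?thesis .
qed

text \<open>If \<open>S\<close> is not inside \<open>U\<close> the event is empty; hence translates
  and sumsets need no check that they lie in the ground set.\<close>

lemma bernoulli_weight_superset_le:
  assumes "finite U" "0 \<le> p"
  shows "bernoulli_weight p U {A. S \<subseteq> A} \<le> p ^ card S"
proof (cases "S \<subseteq> U")
  case False
  then have "{A. S \<subseteq> A} \<inter> Pow U = {}"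
    by auto
  then show ?thesis
    using assms by (simp add: bernoulli_weight_def)
qed (simp add: bernoulli_weight_superset assms)

section \<open>Sumsets\<close>

text \<open>Greedy selection in the graph \<open>R\<close>: picking a vertex and deleting its
  neighbours, itself included, costs at most \<open>d\<close> vertices, so \<open>m * d\<close>
  vertices allow \<open>m\<close> picks.\<close>

lemma exists_independent_subset:
  assumes "finite V" "0 < d" "m * d \<le> card V"
    and "\<And>v. v \<in> V \<Longrightarrow> R v v" and "\<And>v w. R v w \<Longrightarrow> R w v"
    and "\<And>v. v \<in> V \<Longrightarrow> card {w \<in> V. R v w} \<le> d"
  shows "\<exists>I\<subseteq>V. card I = m \<and> (\<forall>v\<in>I. \<forall>w\<in>I. v \<noteq> w \<longrightarrow> \<not> R v w)"
  using assms
proof (induction m arbitrary: V)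
  case 0
  then show ?case by (intro exI[of _ "{}"]) auto
next
  case (Suc m)
  have "card V > 0"
    using Suc.prems(2,3) by auto
  then obtain v where v: "v \<in> V"
    by (metis card_gt_0_iff equals0I)
  define V' where "V' = V - {w \<in> V. R v w}"
  have "card V - card {w \<in> V. R v w} \<le> card V'"
    unfolding V'_def by (intro diff_card_le_card_Diff) (use Suc.prems in auto)
  then have "m * d \<le> card V'"
    using Suc.prems(3) Suc.prems(6)[OF v] by simp
  moreover have "card {w \<in> V'. R u w} \<le> d" if "u \<in> V'" for u
  proof -
    have "card {w \<in> V'. R u w} \<le> card {w \<in> V. R u w}"
      using Suc.prems(1) by (intro card_mono) (auto simp: V'_def)
    also have "\<dots> \<le> d"
      using that by (intro Suc.prems(6)) (auto simp: V'_def)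
    finally show ?thesis .
  qed
  ultimately have "\<exists>I\<subseteq>V'. card I = m \<and> (\<forall>v\<in>I. \<forall>w\<in>I. v \<noteq> w \<longrightarrow> \<not> R v w)"
    using Suc.prems(1,2,4,5) by (intro Suc.IH) (auto simp: V'_def)
  then obtain I where I: "I \<subseteq> V'" "card I = m" "\<And>v w. v \<in> I \<Longrightarrow> w \<in> I \<Longrightarrow> v \<noteq> w \<Longrightarrow> \<not> R v w"
    by blast
  have "finite I"
    using I(1) Suc.prems(1) unfolding V'_def by (meson finite_Diff finite_subset)
  moreover have "v \<notin> I"
    using I(1) v Suc.prems(4)[OF v] by (auto simp: V'_def)
  ultimately have "card (insert v I) = Suc m"
    using I(2) by simp
  moreover have "insert v I \<subseteq> V"
    using I(1) v by (auto simp: V'_def)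
  moreover have "\<not> R v w \<and> \<not> R w v" if "w \<in> I" for w
    using that I(1) Suc.prems(5)[of w v] by (auto simp: V'_def)
  ultimately show ?case
    using I(3) by (intro exI[of _ "insert v I"]) blast
qed

lemma card_set_plus_le:
  assumes "finite B" "finite C"
  shows "card (B + C) \<le> card B * card C"
proof -
  have "B + C = (\<lambda>(b, c). b + c) ` (B \<times> C)"
    by (auto simp: set_plus_def)
  then show ?thesis
    using card_image_le[of "B \<times> C" "\<lambda>(b, c). b + c"] assms by (simp add: card_cartesian_product)
qed

text \<open>Fix \<open>t\<close> elements \<open>B'\<close> of \<open>B\<close> and let
  \<open>c\<close>, \<open>c'\<close> conflict if their translates of \<open>B'\<close> meet. Each
  \<open>c\<close> has at most \<open>t^2\<close> conflicts, so greedy selection among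
  \<open>t^3\<close> elements of \<open>C\<close> yields \<open>t\<close> pairwise disjoint
  translates.\<close>

lemma exists_direct_sumset:
  fixes B C :: "nat set"
  assumes "finite C" "t \<le> card B" "t ^ 3 \<le> card C" "0 < t"
  shows "\<exists>B'\<subseteq>B. \<exists>C'\<subseteq>C. card B' = t \<and> card C' = t \<and> card (B' + C') = t\<^sup>2"
proof -
  obtain B' where B': "B' \<subseteq> B" "card B' = t" "finite B'"
    using assms(2) obtain_subset_with_card_n by metis
  define R where "R = (\<lambda>c c'. \<exists>b\<in>B'. \<exists>b'\<in>B'. b + c = b' + c')"
  have "B' \<noteq> {}"
    using B' assms(4) by auto
  have deg: "card {c' \<in> C. R c c'} \<le> t\<^sup>2" for c
  proof -
    \<comment> \<open>The truncated subtraction is exact here because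
      \<open>b + c = b' + c'\<close>.\<close>
    have "{c' \<in> C. R c c'} \<subseteq> (\<lambda>(b, b'). b + c - b') ` (B' \<times> B')"
      unfolding R_def by force
    then have "card {c' \<in> C. R c c'} \<le> card (B' \<times> B')"
      using B'(3) by (intro surj_card_le) auto
    then show ?thesis
      using B' by (simp add: card_cartesian_product power2_eq_square)
  qed
  have "\<exists>I\<subseteq>C. card I = t \<and> (\<forall>v\<in>I. \<forall>w\<in>I. v \<noteq> w \<longrightarrow> \<not> R v w)"
  proof (rule exists_independent_subset[where d = "t\<^sup>2"])
    show "t * t\<^sup>2 \<le> card C"
      using assms(3) by (simp add: power3_eq_cube power2_eq_square)
    show "R v v" for v
      using \<open>B' \<noteq> {}\<close> by (auto simp: R_def)
    show "R w v" if "R v w" for v w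
      using that unfolding R_def by metis
  qed (use assms deg in auto)
  then obtain C' where C': "C' \<subseteq> C" "card C' = t"
    "\<And>v w. v \<in> C' \<Longrightarrow> w \<in> C' \<Longrightarrow> v \<noteq> w \<Longrightarrow> \<not> R v w"
    by blast
  have "inj_on (\<lambda>(b, c). b + c) (B' \<times> C')"
  proof (rule inj_onI, clarsimp)
    fix b c b' c' assume *: "b \<in> B'" "c \<in> C'" "b' \<in> B'" "c' \<in> C'" "b + c = b' + c'"
    then have "R c c'"
      unfolding R_def by blast
    then have "c = c'"
      using C'(3) * by blast
    then show "b = b' \<and> c = c'"
      using * by simp
  qed
  moreover have "B' + C' = (\<lambda>(b, c). b + c) ` (B' \<times> C')"
    by (auto simp: set_plus_def)
  ultimately have "card (B' + C') = t\<^sup>2"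
    using B' C' by (simp add: card_image card_cartesian_product power2_eq_square)
  then show ?thesis
    using B' C' by blast
qed

text \<open>Every element \<open>a\<close> of a sumset \<open>B + C\<close> lies in a translate of \<open>B\<close> contained in \<open>B + C\<close>.
  Within \<open>{..n}\<close>, whether this happens at \<open>a\<close> only depends on the trace on \<open>window n B a\<close>.\<close>

definition window :: "nat \<Rightarrow> nat set \<Rightarrow> nat \<Rightarrow> nat set" where
  "window n B a = {y. y \<le> n \<and> (\<exists>b\<in>B. \<exists>b'\<in>B. y + b = a + b')}"

definition covered :: "nat set \<Rightarrow> nat \<Rightarrow> nat set set" where
  "covered B a = {Y. a \<in> Y \<longrightarrow> (\<exists>z. \<exists>b\<in>B. z + b = a \<and> (+) z ` B \<subseteq> Y)}"

lemma finite_window: "finite (window n B a)"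
  by (rule finite_subset[of _ "{..n}"]) (auto simp: window_def)

lemma card_window_le:
  assumes "finite B"
  shows "card (window n B a) \<le> (card B)\<^sup>2"
proof -
  have "window n B a \<subseteq> (\<lambda>(b, b'). a + b' - b) ` (B \<times> B)"
    unfolding window_def by force
  then have "card (window n B a) \<le> card (B \<times> B)"
    using assms by (intro surj_card_le) auto
  then show ?thesis
    by (simp add: card_cartesian_product power2_eq_square)
qed

text \<open>For \<open>a = b + c\<close> the witness is the translate of \<open>B\<close> by
  \<open>c\<close>. It lies in \<open>A\<close>, and in the window since
  \<open>c + b' + b = a + b'\<close>, so passing to the trace loses nothing.\<close>

lemma set_plus_covered:
  assumes "A = B + C" "A \<subseteq> {..n}"
  shows "A \<inter> window n B a \<in> covered B a"
  unfolding covered_def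
proof clarsimp
  assume "a \<in> A"
  then obtain b c where bc: "b \<in> B" "c \<in> C" "a = b + c"
    using assms by (auto simp: set_plus_def)
  have "c + b' \<in> A" if "b' \<in> B" for b'
    using that bc assms set_plus_intro[of b' B c C] by (simp add: add.commute)
  moreover have "c + b' \<in> window n B a" if "b' \<in> B" for b'
  proof -
    have "c + b' \<le> n" "c + b' + b = a + b'"
      using calculation[OF that] assms(2) bc by auto
    then show ?thesis
      using bc that unfolding window_def by blast
  qed
  ultimately show "\<exists>z. (\<exists>b\<in>B. z + b = a) \<and> (+) z ` B \<subseteq> A \<and> (+) z ` B \<subseteq> window n B a"
    using bc by (intro exI[of _ c]) auto
qed

text \<open>If the windows of \<open>a\<close> and \<open>a'\<close> meet, then
  \<open>a' = a + b' + c - (b + c')\<close> for four elements of \<open>B\<close>. So each position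
  excludes at most \<open>t^4\<close> others, and greedy selection applies.\<close>

lemma exists_disjoint_windows:
  assumes "finite B" "B \<noteq> {}" "card B \<le> t" "m * t ^ 4 \<le> n"
  shows "\<exists>I\<subseteq>{..n}. card I = m \<and> (\<forall>a\<in>I. \<forall>a'\<in>I. a \<noteq> a' \<longrightarrow> window n B a \<inter> window n B a' = {})"
proof -
  define R where "R = (\<lambda>a a'. a = a' \<or> window n B a \<inter> window n B a' \<noteq> {})"
  have "0 < card B"
    using assms by (simp add: card_gt_0_iff)
  have deg: "card {a' \<in> {..n}. R a a'} \<le> t ^ 4" for a
  proof -
    let ?f = "\<lambda>((b, b'), (c, c')). a + b + c - (b' + c')"
    have "{a' \<in> {..n}. R a a'} \<subseteq> ?f ` ((B \<times> B) \<times> (B \<times> B))"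
    proof clarify
      fix a' assume "R a a'"
      then consider "a = a'" | y where "y \<in> window n B a" "y \<in> window n B a'"
        unfolding R_def by blast
      then show "a' \<in> ?f ` ((B \<times> B) \<times> (B \<times> B))"
      proof cases
        case 1
        obtain b where "b \<in> B"
          using assms(2) by blast
        then show ?thesis
          using 1 by (intro image_eqI[of _ _ "((b, b), (b, b))"]) auto
      next
        case 2
        then obtain b b' c c' where "b \<in> B" "b' \<in> B" "c \<in> B" "c' \<in> B"
          "y + b = a + b'" "y + c = a' + c'"
          unfolding window_def by blast
        then show ?thesis
          by (intro image_eqI[of _ _ "((b', b), (c, c'))"]) auto
      qed
    qed
    then have "card {a' \<in> {..n}. R a a'} \<le> card ((B \<times> B) \<times> (B \<times> B))"
      using assms(1) by (intro surj_card_le) auto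
    also have "\<dots> = card B ^ 4"
      by (simp add: card_cartesian_product power4_eq_xxxx)
    also have "\<dots> \<le> t ^ 4"
      using assms(3) by (intro power_mono) auto
    finally show ?thesis .
  qed
  have "\<exists>I\<subseteq>{..n}. card I = m \<and> (\<forall>v\<in>I. \<forall>w\<in>I. v \<noteq> w \<longrightarrow> \<not> R v w)"
    using assms \<open>0 < card B\<close> deg
    by (intro exists_independent_subset[where d = "t ^ 4"]) (auto simp: R_def)
  then show ?thesis
    unfolding R_def by blast
qed

section \<open>The probability that a position is covered\<close>

text \<open>Either \<open>a\<close> is missing, or one of the \<open>card B\<close> translates of
  \<open>B\<close> through \<open>a\<close> is contained in the random set. This bound is useful for
  large \<open>B\<close>.\<close>

lemma bernoulli_weight_covered_le_translates:
  assumes "finite X" "a \<in> X" "finite B" "0 \<le> p" "p \<le> 1"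
  shows "bernoulli_weight p X (covered B a) \<le> 1 - p + real (card B) * p ^ card B"
proof -
  \<comment> \<open>For \<open>b > a\<close> the truncated difference is 0; the spurious translate
    only enlarges the union.\<close>
  let ?T = "\<lambda>b. {Y. (+) (a - b) ` B \<subseteq> Y}"
  have "bernoulli_weight p X (covered B a) \<le> bernoulli_weight p X (- {Y. {a} \<subseteq> Y} \<union> (\<Union>b\<in>B. ?T b))"
  proof (intro bernoulli_weight_mono subsetI)
    fix Y assume Y: "Y \<in> covered B a \<inter> Pow X"
    show "Y \<in> - {Y. {a} \<subseteq> Y} \<union> (\<Union>b\<in>B. ?T b)"
    proof (cases "a \<in> Y")
      case True
      then obtain z b where "b \<in> B" "z + b = a" "(+) z ` B \<subseteq> Y"
        using Y by (auto simp: covered_def)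
      then have "(+) (a - b) ` B \<subseteq> Y"
        by auto
      then show ?thesis
        using \<open>b \<in> B\<close> by blast
    qed simp
  qed (use assms in auto)
  also have "\<dots> \<le> bernoulli_weight p X (- {Y. {a} \<subseteq> Y}) + bernoulli_weight p X (\<Union>b\<in>B. ?T b)"
    using assms by (intro bernoulli_weight_Un_le) auto
  also have "bernoulli_weight p X (- {Y. {a} \<subseteq> Y}) = 1 - p"
    using assms by (subst bernoulli_weight_Compl, simp, subst bernoulli_weight_superset) auto
  also have "bernoulli_weight p X (\<Union>b\<in>B. ?T b) \<le> real (card B) * p ^ card B"
  proof (rule bernoulli_weight_UN_le_const)
    fix b
    have "card ((+) (a - b) ` B) = card B"
      by (simp add: card_image)
    then show "bernoulli_weight p X (?T b) \<le> p ^ card B"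
      using bernoulli_weight_superset_le[of X p "(+) (a - b) ` B"] assms by simp
  qed (use assms in auto)
  finally show ?thesis by simp
qed

text \<open>The trace \<open>{a}\<close> is not covered, as it is too small to contain a translate
  of \<open>B\<close>. This bound is useful when \<open>B\<close>, and hence its window, is
  small.\<close>

lemma bernoulli_weight_covered_le_singleton:
  assumes "finite X" "a \<in> X" "2 \<le> card B" "0 \<le> p" "p \<le> 1"
  shows "bernoulli_weight p X (covered B a) \<le> 1 - p * (1 - p) ^ card X"
proof -
  have "{a} \<notin> covered B a"
  proof
    assume "{a} \<in> covered B a"
    then obtain z where "(+) z ` B \<subseteq> {a}"
      by (auto simp: covered_def)
    then have "card ((+) z ` B) \<le> card {a}"
      by (intro card_mono) auto
    then show False
      using assms(3) by (simp add: card_image)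
  qed
  then have "bernoulli_weight p X (covered B a) \<le> bernoulli_weight p X (- {{a}})"
    using assms by (intro bernoulli_weight_mono) auto
  also have "\<dots> = 1 - p * (1 - p) ^ card (X - {a})"
    using assms by (simp add: bernoulli_weight_Compl) (simp add: bernoulli_weight_def)
  also have "\<dots> \<le> 1 - p * (1 - p) ^ card X"
    using assms by (auto intro!: mult_left_mono power_decreasing card_mono)
  finally show ?thesis .
qed

text \<open>The constant must not depend on \<open>B\<close>, whose size may grow with
  \<open>n\<close>. Choose \<open>K\<close> with \<open>r * p^r < p / 2\<close> for
  \<open>r \<ge> K\<close>: the translate bound handles \<open>card B \<ge> K\<close>, and below
  \<open>K\<close> windows have at most \<open>K^2\<close> elements, so the singleton bound
  applies.\<close>

lemma bernoulli_weight_covered_uniform: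
  assumes "0 < p" "p < 1"
  shows "\<exists>\<delta>>0. \<delta> < 1 \<and> (\<forall>n B a. finite B \<longrightarrow> 2 \<le> card B \<longrightarrow> a \<le> n \<longrightarrow>
    bernoulli_weight p (window n B a) (covered B a) \<le> 1 - \<delta>)"
proof -
  have "(\<lambda>r. real r * p ^ r) \<longlonglongrightarrow> 0"
    using powser_times_n_limit_0[of p] assms by simp
  then have "\<forall>\<^sub>F r in sequentially. real r * p ^ r < p / 2"
    using assms by (intro order_tendstoD) auto
  then obtain K where K: "\<And>r. K \<le> r \<Longrightarrow> real r * p ^ r < p / 2"
    by (auto simp: eventually_sequentially)
  define \<delta> where "\<delta> = min (p / 2) (p * (1 - p) ^ K\<^sup>2)"
  have "bernoulli_weight p (window n B a) (covered B a) \<le> 1 - \<delta>"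
    if B: "finite B" "2 \<le> card B" and a: "a \<le> n" for n B a
  proof -
    have "B \<noteq> {}"
      using B by auto
    then have aw: "a \<in> window n B a"
      using a by (auto simp: window_def)
    show ?thesis
    proof (cases "K \<le> card B")
      case True
      have "bernoulli_weight p (window n B a) (covered B a) \<le> 1 - p + real (card B) * p ^ card B"
        using assms B aw by (intro bernoulli_weight_covered_le_translates finite_window) auto
      also have "\<dots> \<le> 1 - p / 2"
        using K[OF True] by simp
      also have "\<dots> \<le> 1 - \<delta>"
        unfolding \<delta>_def by simp
      finally show ?thesis .
    next
      case False
      have "bernoulli_weight p (window n B a) (covered B a) \<le> 1 - p * (1 - p) ^ card (window n B a)"
        using assms B aw by (intro bernoulli_weight_covered_le_singleton finite_window) auto
      also have "\<dots> \<le> 1 - p * (1 - p) ^ K\<^sup>2"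
      proof -
        have "card (window n B a) \<le> (card B)\<^sup>2"
          using B by (intro card_window_le)
        also have "\<dots> \<le> K\<^sup>2"
          using False by (intro power_mono) auto
        finally have "card (window n B a) \<le> K\<^sup>2" .
        then have "(1 - p) ^ K\<^sup>2 \<le> (1 - p) ^ card (window n B a)"
          using assms by (intro power_decreasing) auto
        then show ?thesis
          using assms by simp
      qed
      also have "\<dots> \<le> 1 - \<delta>"
        unfolding \<delta>_def by simp
      finally show ?thesis .
    qed
  qed
  moreover have "0 < \<delta>" "\<delta> < 1"
    using assms by (auto simp: \<delta>_def)
  ultimately show ?thesis by blast
qed

section \<open>Union bounds for the two kinds of sumset\<close>

lemma card_subsets_of_card_le:
  "card {B. B \<subseteq> {..n::nat} \<and> card B = r} \<le> (n + 1) ^ r"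
proof (cases "r \<le> n + 1")
  case True
  then show ?thesis
    using n_subsets[of "{..n}" r] binomial_le_pow[of r "n + 1"] by simp
next
  case False
  then have "Suc n choose r = 0"
    by (intro binomial_eq_0) simp
  then show ?thesis
    using n_subsets[of "{..n}" r] by (simp only: card_atMost finite_atMost le0)
qed

lemma finite_subsets_conj: "finite {B. B \<subseteq> {..n::nat} \<and> P B}"
  by (rule finite_subset[of _ "Pow {..n}"]) auto

lemma bernoulli_weight_direct_sumset_le:
  assumes "0 \<le> p" "p \<le> 1"
  shows "bernoulli_weight p {..n} {A. \<exists>B C. B \<subseteq> {..n} \<and> C \<subseteq> {..n} \<and> card B = t \<and> card C = t \<and>
      card (B + C) = t\<^sup>2 \<and> B + C \<subseteq> A} \<le> real (n + 1) ^ (2 * t) * p ^ t\<^sup>2"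
    (is "bernoulli_weight _ _ ?F \<le> _")
proof -
  let ?S = "{B. B \<subseteq> {..n} \<and> card B = t}"
  let ?I = "{(B, C) \<in> ?S \<times> ?S. card (B + C) = t\<^sup>2}"
  have fin: "finite (?S \<times> ?S)"
    by (intro finite_cartesian_product finite_subsets_conj)
  have "card ?I \<le> card (?S \<times> ?S)"
    using fin by (intro card_mono) auto
  also have "\<dots> \<le> (n + 1) ^ t * (n + 1) ^ t"
    unfolding card_cartesian_product by (intro mult_mono card_subsets_of_card_le) auto
  also have "\<dots> = (n + 1) ^ (2 * t)"
    by (simp add: mult_2 power_add)
  finally have "real (card ?I) \<le> real ((n + 1) ^ (2 * t))"
    by (simp only: of_nat_le_iff)
  then have card: "real (card ?I) \<le> real (n + 1) ^ (2 * t)"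
    by (simp only: of_nat_power)
  have "bernoulli_weight p {..n} ?F \<le> bernoulli_weight p {..n} (\<Union>x\<in>?I. {A. fst x + snd x \<subseteq> A})"
  proof (intro bernoulli_weight_mono subsetI)
    fix A assume "A \<in> ?F \<inter> Pow {..n}"
    then obtain B C where "(B, C) \<in> ?I" "B + C \<subseteq> A"
      by blast
    then show "A \<in> (\<Union>x\<in>?I. {A. fst x + snd x \<subseteq> A})"
      by (intro UN_I[of "(B, C)"]) simp_all
  qed (use assms in auto)
  also have "\<dots> \<le> real (n + 1) ^ (2 * t) * p ^ t\<^sup>2"
  proof (rule bernoulli_weight_UN_le_const[OF _ assms _ _ card])
    show "finite ?I"
      using fin by (rule finite_subset[rotated]) auto
    show "bernoulli_weight p {..n} {A. fst x + snd x \<subseteq> A} \<le> p ^ t\<^sup>2" if "x \<in> ?I" for x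
      using that bernoulli_weight_superset_le[of "{..n}" p "fst x + snd x"] assms by auto
  qed (use assms in auto)
  finally show ?thesis .
qed

text \<open>For a fixed \<open>B\<close> there are \<open>m\<close> positions with disjoint windows;
  being covered there are independent events, each of probability at most
  \<open>1 - \<delta>\<close>. A union bound over \<open>B\<close> follows.\<close>

lemma bernoulli_weight_union_of_translates_le:
  assumes p: "0 \<le> p" "p \<le> 1" and "m * t ^ 4 \<le> n" and "\<delta> < 1"
    and \<delta>: "\<And>B a. finite B \<Longrightarrow> 2 \<le> card B \<Longrightarrow> a \<le> n \<Longrightarrow>
      bernoulli_weight p (window n B a) (covered B a) \<le> 1 - \<delta>"
  shows "bernoulli_weight p {..n} {A. \<exists>B. B \<subseteq> {..n} \<and> 2 \<le> card B \<and> card B \<le> t \<and>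
      (\<forall>a\<le>n. A \<inter> window n B a \<in> covered B a)} \<le> real t * real (n + 1) ^ t * (1 - \<delta>) ^ m"
    (is "bernoulli_weight _ _ ?F \<le> _")
proof -
  let ?I = "{B. B \<subseteq> {..n} \<and> 2 \<le> card B \<and> card B \<le> t}"
  let ?E = "\<lambda>B. {A. \<forall>a\<le>n. A \<inter> window n B a \<in> covered B a}"
  have "card ?I \<le> card (\<Union>r\<in>{1..t}. {B. B \<subseteq> {..n} \<and> card B = r})"
    using finite_subsets_conj by (intro card_mono) auto
  also have "\<dots> \<le> (\<Sum>r\<in>{1..t}. card {B. B \<subseteq> {..n} \<and> card B = r})"
    by (intro card_UN_le) auto
  also have "\<dots> \<le> (\<Sum>r\<in>{1..t}. (n + 1) ^ t)"
    by (intro sum_mono order_trans[OF card_subsets_of_card_le] power_increasing) auto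
  finally have "real (card ?I) \<le> real (t * (n + 1) ^ t)"
    by (simp only: of_nat_le_iff) simp
  then have card: "real (card ?I) \<le> real t * real (n + 1) ^ t"
    by (simp only: of_nat_power of_nat_mult)
  have "bernoulli_weight p {..n} ?F \<le> bernoulli_weight p {..n} (\<Union>B\<in>?I. ?E B)"
    using p by (intro bernoulli_weight_mono) auto
  also have "\<dots> \<le> real t * real (n + 1) ^ t * (1 - \<delta>) ^ m"
  proof (rule bernoulli_weight_UN_le_const[OF _ p _ _ card])
    show "finite ?I"
      by (rule finite_subsets_conj)
    fix B assume B: "B \<in> ?I"
    then have B': "finite B" "2 \<le> card B" "card B \<le> t" "B \<noteq> {}"
      by (auto intro: finite_subset)
    obtain I where I: "I \<subseteq> {..n}" "card I = m"
      "\<And>a a'. a \<in> I \<Longrightarrow> a' \<in> I \<Longrightarrow> a \<noteq> a' \<Longrightarrow> window n B a \<inter> window n B a' = {}"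
      using exists_disjoint_windows[OF B'(1,4,3) assms(3)] by blast
    have "bernoulli_weight p {..n} (?E B) \<le>
        bernoulli_weight p {..n} {A. \<forall>a\<in>I. A \<inter> window n B a \<in> covered B a}"
      using p I(1) by (intro bernoulli_weight_mono) auto
    also have "\<dots> = (\<Prod>a\<in>I. bernoulli_weight p (window n B a) (covered B a))"
    proof (intro bernoulli_weight_independent I(3))
      show "finite I"
        using I(1) finite_subset by blast
    qed (auto simp: window_def)
    also have "\<dots> \<le> (\<Prod>a\<in>I. 1 - \<delta>)"
      using I(1) B' p by (intro prod_mono conjI \<delta> bernoulli_weight_nonneg) auto
    finally show "bernoulli_weight p {..n} (?E B) \<le> (1 - \<delta>) ^ m"
      using I(2) by simp
  qed (use assms in auto)
  finally show ?thesis .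
qed

lemma sumset_cases:
  fixes B C :: "nat set"
  assumes BC: "B \<in> Pfin0" "C \<in> Pfin0" "B \<noteq> {0}" "C \<noteq> {0}"
    and "B + C \<subseteq> {..n}" "t ^ 6 \<le> card (B + C)" "0 < t"
  shows "(\<exists>B' C'. B' \<subseteq> {..n} \<and> C' \<subseteq> {..n} \<and> card B' = t \<and> card C' = t \<and>
        card (B' + C') = t\<^sup>2 \<and> B' + C' \<subseteq> B + C) \<or>
    (\<exists>B'. B' \<subseteq> {..n} \<and> 2 \<le> card B' \<and> card B' \<le> t \<and>
        (\<forall>a\<le>n. (B + C) \<inter> window n B' a \<in> covered B' a))"
  using assms
proof (induction "card B" "card C" arbitrary: B C rule: linorder_wlog)
  \<comment> \<open>The conclusion depends on \<open>B\<close> and \<open>C\<close> only through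
    \<open>B + C\<close>, so one may assume \<open>card B \<le> card C\<close>.\<close>
  case sym
  then show ?case
    by (metis add.commute)
next
  case le
  then have fin: "finite B" "finite C" and zero: "0 \<in> B" "0 \<in> C"
    by (auto simp: Pfin0_def)
  \<comment> \<open>Since 0 lies in both summands, they are themselves subsets of
    \<open>{..n}\<close>; this keeps the number of choices finite and small.\<close>
  have sub: "B \<subseteq> B + C" "C \<subseteq> B + C"
    using zero by (force simp: set_plus_def)+
  have C: "t ^ 3 \<le> card C"
  proof (rule ccontr)
    assume "\<not> t ^ 3 \<le> card C"
    then have "card B * card C < t ^ 3 * t ^ 3"
      using le(1) by (intro mult_strict_mono') auto
    then show False
      using le(7) card_set_plus_le[OF fin] by (simp flip: power_add)
  qed
  show ?case
  proof (cases "t \<le> card B")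
    case True
    then obtain B' C' where "B' \<subseteq> B" "C' \<subseteq> C" "card B' = t" "card C' = t" "card (B' + C') = t\<^sup>2"
      using exists_direct_sumset[OF fin(2) True C le(8)] by blast
    moreover from this have "B' + C' \<subseteq> B + C"
      by (intro set_plus_mono2)
    moreover from calculation have "B' \<subseteq> {..n}" "C' \<subseteq> {..n}"
      using sub le(6) by (blast intro: order_trans)+
    ultimately show ?thesis
      by blast
  next
    case False
    have "2 \<le> card B"
    proof -
      obtain b where "b \<in> B" "b \<noteq> 0"
        using le(4) zero by auto
      then have "card {0, b} \<le> card B"
        using zero fin by (intro card_mono) auto
      then show ?thesis
        using \<open>b \<noteq> 0\<close> by simp
    qed
    moreover have "\<forall>a\<le>n. (B + C) \<inter> window n B a \<in> covered B a"
      using set_plus_covered[OF refl le(6)] by blast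
    ultimately show ?thesis
      using False sub le(6) by (intro disjI2 exI[of _ B]) auto
  qed
qed

section \<open>From Bernoulli weights to sets of fixed size\<close>

text \<open>The ratio of consecutive binomial probabilities, with denominators cleared.\<close>

lemma binomial_term_Suc:
  fixes p :: real
  assumes "j < n"
  shows "real (n choose Suc j) * p ^ Suc j * (1 - p) ^ (n - Suc j) * (real (Suc j) * (1 - p)) =
    real (n choose j) * p ^ j * (1 - p) ^ (n - j) * (real (n - j) * p)"
proof -
  have "Suc j * (n choose Suc j) = (n - j) * (n choose j)"
    by (simp only: binomial_absorption binomial_absorb_comp)
  then have *: "real (Suc j) * real (n choose Suc j) = real (n - j) * real (n choose j)"
    by (metis of_nat_mult)
  have "(1 - p) ^ (n - j) = (1 - p) ^ (n - Suc j) * (1 - p)"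
    using assms by (metis Suc_diff_Suc power_Suc2)
  then have "real (n choose j) * p ^ j * (1 - p) ^ (n - j) * (real (n - j) * p) =
      (real (n - j) * real (n choose j)) * (p ^ Suc j * (1 - p) ^ (n - Suc j) * (1 - p))"
    by simp
  then show ?thesis
    unfolding *[symmetric] by (simp only: mult_ac)
qed

text \<open>The binomial distribution with parameters \<open>n\<close> and \<open>p\<close> has its mode at \<open>p n\<close> if this is an
  integer, and the preceding term is at least half as large.\<close>

lemma binomial_term_below_mode_ge:
  fixes p :: real
  assumes p: "0 < p" "p < 1" and k: "real k = p * real n" and "1 \<le> n"
  shows "1 \<le> 2 * real (n + 1) * (real (n choose (k - 1)) * p ^ (k - 1) * (1 - p) ^ (n - (k - 1)))"
proof -
  define T where "T = (\<lambda>j. real (n choose j) * p ^ j * (1 - p) ^ (n - j))"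
  have T_nonneg: "0 \<le> T j" for j
    using p by (simp add: T_def)
  have T_Suc: "T (Suc j) * (real (Suc j) * (1 - p)) = T j * (real (n - j) * p)" if "j < n" for j
    unfolding T_def using that by (rule binomial_term_Suc)
  have "0 < real k" "real k < real n"
    using k p assms(4) by simp_all
  then have kn: "0 < k" "k < n"
    by simp_all
  \<comment> \<open>The terms increase at \<open>j\<close> as long as
    \<open>j + 1 \<le> (n + 1) p\<close>, which \<open>j + 1 \<le> k = n p\<close> ensures. For
    \<open>j \<ge> k\<close> one has \<open>j + 1 \<ge> n p + 1 > (n + 1) p\<close>, so they
    decrease.\<close>
  have up: "T j \<le> T (Suc j)" if "j < k" for j
  proof -
    have "real (Suc j) * (1 - p) \<le> real (n - j) * p"
    proof -
      have "real j + 1 \<le> real n * p"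
        using that k by (simp add: mult.commute)
      then show ?thesis
        using that kn p by (simp add: of_nat_diff algebra_simps)
    qed
    then have "T j * (real (Suc j) * (1 - p)) \<le> T (Suc j) * (real (Suc j) * (1 - p))"
      using T_Suc[of j] T_nonneg[of j] that kn by (simp add: mult_left_mono)
    then show ?thesis
      using p by (simp add: mult_le_cancel_right)
  qed
  have down: "T (Suc j) \<le> T j" if "k \<le> j" for j
  proof (cases "j < n")
    case True
    have "real (n - j) * p \<le> real (Suc j) * (1 - p)"
    proof -
      have "real n * p \<le> real j + 1 - p"
        using that k p by (simp add: mult.commute)
      then show ?thesis
        using True by (simp add: of_nat_diff algebra_simps)
    qed
    then have "T (Suc j) * (real (Suc j) * (1 - p)) \<le> T j * (real (Suc j) * (1 - p))"
      using T_Suc[OF True] T_nonneg[of j] by (simp add: mult_left_mono)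
    then show ?thesis
      using p by (simp add: mult_le_cancel_right)
  next
    case False
    then have "T (Suc j) = 0"
      by (simp add: T_def binomial_eq_0)
    then show ?thesis
      using T_nonneg by simp
  qed
  have mode: "T j \<le> T k" for j
  proof (cases "j \<le> k")
    case True
    then show ?thesis
      by (induction j rule: inc_induct) (use up order_trans in blast)+
  next
    case False
    then have "k \<le> j" by simp
    then show ?thesis
      by (induction j rule: dec_induct) (use down order_trans in blast)+
  qed
  \<comment> \<open>Since \<open>k (1 - p) = (n - k) p\<close>, the ratio is
    \<open>(n - k + 1) / (n - k)\<close>, at most 2 because \<open>k < n\<close>.\<close>
  have "T k \<le> 2 * T (k - 1)"
  proof -
    have kq: "real k * (1 - p) = (real n - real k) * p"
      using k by (simp add: algebra_simps)
    have "T k * ((real n - real k) * p) = T (k - 1) * ((1 + real n - real k) * p)"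
      using T_Suc[of "k - 1"] kn kq by (simp add: of_nat_diff)
    also have "\<dots> \<le> T (k - 1) * ((2 * (real n - real k)) * p)"
    proof (intro mult_left_mono mult_right_mono)
      have "real (k + 1) \<le> real n"
        using kn by (intro of_nat_mono) simp
      then show "1 + real n - real k \<le> 2 * (real n - real k)"
        by simp
    qed (use p T_nonneg in auto)
    finally have "T k * ((real n - real k) * p) \<le> 2 * T (k - 1) * ((real n - real k) * p)"
      by (simp only: mult_ac)
    moreover have "0 < (real n - real k) * p"
      using kn p by simp
    ultimately show ?thesis
      by (simp only: mult_le_cancel_right)
  qed
  have "1 = (p + (1 - p)) ^ n"
    by simp
  also have "\<dots> = (\<Sum>j\<le>n. T j)"
    unfolding binomial_ring T_def by simp
  also have "\<dots> \<le> (\<Sum>j\<le>n. T k)"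
    by (intro sum_mono mode)
  also have "\<dots> = real (n + 1) * T k"
    by simp
  also have "\<dots> \<le> real (n + 1) * (2 * T (k - 1))"
    using \<open>T k \<le> 2 * T (k - 1)\<close> by (intro mult_left_mono) auto
  finally show ?thesis
    by (simp only: T_def mult_ac)
qed

text \<open>All members of \<open>F\<close> have the same weight, so cardinality and probability are
  proportional. The mode estimate turns the factor into a multiple of
  \<open>n choose (k - 1)\<close>, at a cost of order \<open>n\<close>.\<close>

lemma card_le_bernoulli_weight:
  fixes p :: real
  assumes p: "0 < p" "p < 1" and k: "real k = p * real n" and "1 \<le> n"
    and F: "F \<subseteq> {A. A \<subseteq> {..n} \<and> card A = k}"
  shows "real (card F) * p \<le> 2 * real (n + 1) * real (n choose (k - 1)) * bernoulli_weight p {..n} F"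
proof -
  have "0 < real k" "real k < real n"
    using k p assms(4) by simp_all
  then have kn: "0 < k" "k < n"
    by simp_all
  have "bernoulli_weight p {..n} F = (\<Sum>A\<in>F. p ^ k * (1 - p) ^ (n + 1 - k))"
    unfolding bernoulli_weight_def
  proof (rule sum.cong)
    show "F \<inter> Pow {..n} = F"
      using F by auto
    show "p ^ card A * (1 - p) ^ card ({..n} - A) = p ^ k * (1 - p) ^ (n + 1 - k)" if "A \<in> F" for A
      using that F by (subst card_Diff_subset) (auto intro: finite_subset)
  qed
  \<comment> \<open>The ground set has \<open>n + 1\<close> elements. Splitting off one factor
    \<open>p\<close> leaves exactly the powers in the binomial term for \<open>k - 1\<close>
    successes in \<open>n\<close> trials.\<close>
  also have "\<dots> = real (card F) * (p * p ^ (k - 1) * (1 - p) ^ (n - (k - 1)))"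
    using kn by (simp add: power_eq_if Suc_diff_le)
  finally have W: "bernoulli_weight p {..n} F = real (card F) * (p * p ^ (k - 1) * (1 - p) ^ (n - (k - 1)))" .
  have "real (card F) * p * 1 \<le> real (card F) * p *
      (2 * real (n + 1) * (real (n choose (k - 1)) * p ^ (k - 1) * (1 - p) ^ (n - (k - 1))))"
    using p by (intro mult_left_mono binomial_term_below_mode_ge k assms(4)) auto
  then show ?thesis
    unfolding W by (simp only: mult_ac mult_1_right)
qed

section \<open>Counting non-atoms\<close>

definition non_atoms :: "nat \<Rightarrow> nat \<Rightarrow> nat set set" where
  "non_atoms n k = {A. A \<subseteq> {..n} \<and> 0 \<in> A \<and> card A = k \<and> A \<notin> atoms}"

text \<open>Deleting 0 maps the candidates bijectively to the \<open>(k - 1)\<close>-subsets of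
  \<open>{1..n}\<close>. For \<open>k = 0\<close> there is no candidate, but the truncated
  \<open>k - 1\<close> would give 1 on the right.\<close>

lemma alpha_plus_card_non_atoms:
  assumes "1 \<le> k"
  shows "alpha n k + card (non_atoms n k) = n choose (k - 1)"
proof -
  let ?S = "{A. A \<subseteq> {..n} \<and> 0 \<in> A \<and> card A = k}"
  have "A \<in> atoms_nk n k \<longleftrightarrow> A \<in> ?S" if "A \<in> atoms" for A
  proof -
    have "finite A" "0 \<in> A"
      using that by (auto simp: atoms_def Pfin0_def)
    then have "Max A \<le> n \<longleftrightarrow> (\<forall>a\<in>A. a \<le> n)"
      by (intro Max_le_iff) blast+
    then have "Max A \<le> n \<longleftrightarrow> A \<subseteq> {..n}"
      by blast
    then show ?thesis
      using that \<open>0 \<in> A\<close> by (simp add: atoms_nk_def)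
  qed
  then have "atoms_nk n k = ?S \<inter> atoms"
    by (auto simp: atoms_nk_def)
  then have S: "?S = atoms_nk n k \<union> non_atoms n k" and disj: "atoms_nk n k \<inter> non_atoms n k = {}"
    unfolding non_atoms_def by auto
  have "finite (non_atoms n k)"
    unfolding non_atoms_def by (rule finite_subsets_conj)
  then have "card ?S = alpha n k + card (non_atoms n k)"
    unfolding S alpha_def using disj finite_atoms_nk by (intro card_Un_disjoint)
  moreover have "card ?S = card {B. B \<subseteq> {1..n} \<and> card B = k - 1}"
  proof (rule bij_betw_same_card[OF bij_betw_byWitness[where f' = "insert 0"]])
    show "\<forall>A\<in>?S. insert 0 (A - {0}) = A"
      by auto
    show "\<forall>B\<in>{B. B \<subseteq> {1..n} \<and> card B = k - 1}. insert 0 B - {0} = B"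
      by auto
    show "(\<lambda>A. A - {0}) ` ?S \<subseteq> {B. B \<subseteq> {1..n} \<and> card B = k - 1}"
      by (auto simp: Suc_le_eq)
    show "insert 0 ` {B. B \<subseteq> {1..n} \<and> card B = k - 1} \<subseteq> ?S"
    proof clarify
      fix B assume B: "B \<subseteq> {1..n}" "card B = k - 1"
      then have "finite B" "0 \<notin> B"
        by (auto intro: finite_subset)
      then show "insert 0 B \<subseteq> {..n} \<and> 0 \<in> insert 0 B \<and> card (insert 0 B) = k"
        using B assms by auto
    qed
  qed
  moreover have "card {B. B \<subseteq> {1..n} \<and> card B = k - 1} = n choose (k - 1)"
    using n_subsets[of "{1..n}" "k - 1"] by simp
  ultimately show ?thesis
    by linarith
qed

text \<open>The exponent \<open>7 = 3 + 4\<close> leaves room for \<open>t^3\<close> disjoint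
  windows, each excluding at most \<open>t^4\<close> positions.\<close>

lemma card_non_atoms_le:
  assumes p: "0 < p" "p < 1" and k: "real k = p * real n" and n: "t ^ 7 \<le> n" and t: "2 \<le> t" "1 / p \<le> real t"
    and \<delta>: "\<delta> < 1" "\<And>B a. finite B \<Longrightarrow> 2 \<le> card B \<Longrightarrow> a \<le> n \<Longrightarrow>
      bernoulli_weight p (window n B a) (covered B a) \<le> 1 - \<delta>"
  shows "real (card (non_atoms n k)) * p \<le> 2 * real (n + 1) * real (n choose (k - 1)) *
    (real (n + 1) ^ (2 * t) * p ^ t\<^sup>2 + real t * real (n + 1) ^ t * (1 - \<delta>) ^ t ^ 3)"
proof -
  have "1 \<le> t ^ 7"
    using t by simp
  then have n1: "1 \<le> n"
    using n by linarith
  \<comment> \<open>Since \<open>p * t \<ge> 1\<close>, one of the seven factors \<open>t\<close>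
    absorbs \<open>p\<close>: \<open>k = p n \<ge> p t^7 \<ge> t^6\<close>.\<close>
  have "real (t ^ 6) = real t ^ 6 * 1"
    by simp
  also have "\<dots> \<le> real t ^ 6 * (p * real t)"
    using t p by (intro mult_left_mono) (auto simp: field_simps)
  also have "\<dots> = p * real (t ^ 7)"
    by (simp add: eval_nat_numeral)
  also have "\<dots> \<le> p * real n"
    using n p by (intro mult_left_mono) (simp_all only: of_nat_le_iff less_imp_le)
  finally have tk: "t ^ 6 \<le> k"
    unfolding k[symmetric] of_nat_le_iff .
  \<comment> \<open>Having more than one element rules out \<open>{0}\<close>, so a non-atom does
    split nontrivially.\<close>
  have "1 < t ^ 6"
    using t by (intro one_less_power) auto
  then have k2: "1 < k"
    using tk by linarith
  let ?F1 = "{A. \<exists>B C. B \<subseteq> {..n} \<and> C \<subseteq> {..n} \<and> card B = t \<and> card C = t \<and>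
      card (B + C) = t\<^sup>2 \<and> B + C \<subseteq> A}"
  let ?F2 = "{A. \<exists>B. B \<subseteq> {..n} \<and> 2 \<le> card B \<and> card B \<le> t \<and>
      (\<forall>a\<le>n. A \<inter> window n B a \<in> covered B a)}"
  have sub: "non_atoms n k \<subseteq> ?F1 \<union> ?F2"
  proof
    fix A assume A: "A \<in> non_atoms n k"
    then have A': "A \<subseteq> {..n}" "0 \<in> A" "card A = k" "A \<notin> atoms"
      by (auto simp: non_atoms_def)
    moreover have "A \<in> Pfin0" "A \<noteq> {0}"
      using A' k2 by (auto simp: Pfin0_def intro: finite_subset)
    ultimately obtain B C where BC: "B \<in> Pfin0" "C \<in> Pfin0" "B \<noteq> {0}" "C \<noteq> {0}" and ABC: "A = B + C"
      unfolding atoms_def by blast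
    show "A \<in> ?F1 \<union> ?F2"
      using sumset_cases[OF BC, of n t] A' tk t unfolding ABC by simp
  qed
  have "bernoulli_weight p {..n} (non_atoms n k) \<le> bernoulli_weight p {..n} (?F1 \<union> ?F2)"
    using p sub by (intro bernoulli_weight_mono) auto
  also have "\<dots> \<le> bernoulli_weight p {..n} ?F1 + bernoulli_weight p {..n} ?F2"
    using p by (intro bernoulli_weight_Un_le) auto
  also have "\<dots> \<le> real (n + 1) ^ (2 * t) * p ^ t\<^sup>2 + real t * real (n + 1) ^ t * (1 - \<delta>) ^ t ^ 3"
  proof (rule add_mono)
    have "t ^ 3 * t ^ 4 \<le> n"
      using n by (simp flip: power_add)
    then show "bernoulli_weight p {..n} ?F2 \<le> real t * real (n + 1) ^ t * (1 - \<delta>) ^ t ^ 3"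
      using p \<delta> by (intro bernoulli_weight_union_of_translates_le) auto
    show "bernoulli_weight p {..n} ?F1 \<le> real (n + 1) ^ (2 * t) * p ^ t\<^sup>2"
      using p by (intro bernoulli_weight_direct_sumset_le) auto
  qed
  finally have W: "bernoulli_weight p {..n} (non_atoms n k) \<le>
      real (n + 1) ^ (2 * t) * p ^ t\<^sup>2 + real t * real (n + 1) ^ t * (1 - \<delta>) ^ t ^ 3" .
  have "real (card (non_atoms n k)) * p \<le>
      2 * real (n + 1) * real (n choose (k - 1)) * bernoulli_weight p {..n} (non_atoms n k)"
    using p k n1 by (intro card_le_bernoulli_weight) (auto simp: non_atoms_def)
  also have "\<dots> \<le> 2 * real (n + 1) * real (n choose (k - 1)) *
      (real (n + 1) ^ (2 * t) * p ^ t\<^sup>2 + real t * real (n + 1) ^ t * (1 - \<delta>) ^ t ^ 3)"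
    using W by (intro mult_left_mono) auto
  finally show ?thesis .
qed

section \<open>Asymptotics with \<open>t\<close> the integer seventh root of
  \<open>n\<close>\<close>

text \<open>Here \<open>(t + 1)^7\<close> stands for \<open>n + 1\<close>. The logarithms of the
  counting factors are of order \<open>t log t\<close>, dominated by the exponents
  \<open>t^2\<close> and \<open>t^3\<close> of \<open>p\<close> and \<open>q\<close>.\<close>

lemma error_term_tendsto_0:
  fixes p q :: real
  assumes "0 < p" "p < 1" "0 < q" "q < 1"
  shows "(\<lambda>t. 2 / p * (real t + 1) ^ 14 * ((real t + 1) ^ (14 * t) * p ^ t\<^sup>2 +
    real t * (real t + 1) ^ (7 * t) * q ^ t ^ 3)) \<longlonglongrightarrow> 0"
  using assms by real_asymp

lemma exists_floor_root:
  fixes n :: nat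
  assumes "0 < d" "T ^ d \<le> n"
  shows "\<exists>t\<ge>T. t ^ d \<le> n \<and> n < (t + 1) ^ d"
proof -
  define t where "t = (GREATEST t. t ^ d \<le> n)"
  have bound: "\<And>x. x ^ d \<le> n \<Longrightarrow> x \<le> n"
  proof -
    fix x assume "x ^ d \<le> n"
    then show "x \<le> n"
      using assms(1) self_le_power[of x d] by (cases "x = 0") auto
  qed
  have "t ^ d \<le> n"
    unfolding t_def using assms(2) bound by (rule GreatestI_nat)
  moreover have "T \<le> t"
    unfolding t_def using assms(2) bound by (rule Greatest_le_nat)
  moreover have "n < (t + 1) ^ d"
  proof (rule ccontr)
    assume "\<not> n < (t + 1) ^ d"
    then have "t + 1 \<le> t"
      unfolding t_def using bound by (intro Greatest_le_nat) auto
    then show False by simp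
  qed
  ultimately show ?thesis by blast
qed

lemma card_non_atoms_eventually_le:
  fixes p :: real
  assumes p: "0 < p" "p < 1"
  shows "\<exists>N. \<forall>n\<ge>N. \<forall>k. real k = p * real n \<longrightarrow>
    real n * real (card (non_atoms n k)) \<le> real (n choose (k - 1))"
proof -
  obtain \<delta> where \<delta>: "0 < \<delta>" "\<delta> < 1" "\<And>n B a. finite B \<Longrightarrow> 2 \<le> card B \<Longrightarrow> a \<le> n \<Longrightarrow>
      bernoulli_weight p (window n B a) (covered B a) \<le> 1 - \<delta>"
    using bernoulli_weight_covered_uniform[OF p] by blast
  \<comment> \<open>The bound is a monotone function of \<open>x\<close>, evaluated first at
    \<open>n + 1\<close> and then at \<open>(t + 1)^7\<close>.\<close>
  define err where "err = (\<lambda>(x::real) t. x ^ (2 * t) * p ^ t\<^sup>2 + real t * x ^ t * (1 - \<delta>) ^ t ^ 3)"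
  have "\<forall>\<^sub>F t in sequentially. 2 / p * (real t + 1) ^ 14 * ((real t + 1) ^ (14 * t) * p ^ t\<^sup>2 +
      real t * (real t + 1) ^ (7 * t) * (1 - \<delta>) ^ t ^ 3) < 1"
    using p \<delta> by (intro order_tendstoD(2)[OF error_term_tendsto_0]) auto
  then obtain T where T: "\<And>t. T \<le> t \<Longrightarrow> 2 / p * (real t + 1) ^ 14 * err ((real t + 1) ^ 7) t < 1"
    by (auto simp: eventually_sequentially err_def simp flip: power_mult)
  define T' where "T' = max T (max 2 (nat \<lceil>1 / p\<rceil>))"
  have "real n * real (card (non_atoms n k)) \<le> real (n choose (k - 1))"
    if n: "T' ^ 7 \<le> n" and k: "real k = p * real n" for n k
  proof -
    obtain t where t: "T' \<le> t" "t ^ 7 \<le> n" "n < (t + 1) ^ 7"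
      using exists_floor_root[OF _ n] by auto
    then have t': "T \<le> t" "2 \<le> t" "1 / p \<le> real t"
      unfolding T'_def by (auto simp: nat_le_iff ceiling_le_iff)
    have "n + 1 \<le> (t + 1) ^ 7"
      using t(3) by simp
    then have nt: "real (n + 1) \<le> (real t + 1) ^ 7"
      by (metis of_nat_le_iff of_nat_power of_nat_add of_nat_1)
    have err_nonneg: "0 \<le> err x t" if "0 \<le> x" for x
      using that p \<delta> by (auto simp: err_def)
    have "real n * real (card (non_atoms n k)) * p = real n * (real (card (non_atoms n k)) * p)"
      by simp
    \<comment> \<open>One factor \<open>n + 1\<close> comes from the mode estimate, the other is the
      \<open>n\<close> on the left that yields decay \<open>1 / n\<close>. Together they give
      \<open>(t + 1)^14\<close>.\<close>
    also have "\<dots> \<le> real (n + 1) * (2 * real (n + 1) * real (n choose (k - 1)) * err (real (n + 1)) t)"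
    proof (rule mult_mono)
      show "real (card (non_atoms n k)) * p \<le>
          2 * real (n + 1) * real (n choose (k - 1)) * err (real (n + 1)) t"
        unfolding err_def using p k t(2) t'(2,3) \<delta>(2,3) by (intro card_non_atoms_le) auto
    qed (use p in auto)
    also have "\<dots> = real (n choose (k - 1)) * (2 * (real (n + 1) * real (n + 1)) * err (real (n + 1)) t)"
      by simp
    also have "\<dots> \<le> real (n choose (k - 1)) *
        (2 * ((real t + 1) ^ 7 * (real t + 1) ^ 7) * err ((real t + 1) ^ 7) t)"
    proof (intro mult_left_mono mult_mono)
      show "err (real (n + 1)) t \<le> err ((real t + 1) ^ 7) t"
        unfolding err_def using nt p \<delta> by (intro add_mono mult_right_mono mult_left_mono power_mono) auto
    qed (use nt err_nonneg in auto)
    also have "\<dots> = real (n choose (k - 1)) * (2 / p * (real t + 1) ^ 14 * err ((real t + 1) ^ 7) t) * p"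
      using p by (simp flip: power_add)
    also have "\<dots> \<le> real (n choose (k - 1)) * 1 * p"
      using T[OF t'(1)] p by (intro mult_right_mono mult_left_mono) auto
    finally show ?thesis
      using p by simp
  qed
  then show ?thesis by blast
qed

section \<open>The error function and its constant\<close>

theorem theorem5p2:
  fixes \<epsilon> :: real
  assumes "0 < \<epsilon>" and "\<epsilon> < 1"
  shows "\<exists>(\<gamma> :: nat \<Rightarrow> real) (C :: real). C > 0
    \<and> (\<forall>n\<ge>1. \<bar>\<gamma> n\<bar> \<le> C / real n)
    \<and> \<gamma> \<longlonglongrightarrow> 0
    \<and> (\<forall>(n::nat) (k::nat). n \<ge> 1 \<and> real k = \<epsilon> * real n \<longrightarrow>
          real (alpha n k) = real (n choose (k - 1)) * (1 - \<gamma> n))"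
proof -
  obtain N where N: "\<And>n k. N \<le> n \<Longrightarrow> real k = \<epsilon> * real n \<Longrightarrow>
      real n * real (card (non_atoms n k)) \<le> real (n choose (k - 1))"
    using card_non_atoms_eventually_le[OF assms] by blast
  \<comment> \<open>The error depends on \<open>n\<close> alone, so the floor recovers
    \<open>k\<close> whenever \<open>\<epsilon> * n\<close> is an integer; otherwise, and at
    \<open>n = 0\<close>, \<open>\<gamma> n\<close> is set to 0.\<close>
  define \<kappa> where "\<kappa> = (\<lambda>n. nat \<lfloor>\<epsilon> * real n\<rfloor>)"
  define \<gamma> where "\<gamma> = (\<lambda>n. if 1 \<le> n \<and> real (\<kappa> n) = \<epsilon> * real n
    then real (card (non_atoms n (\<kappa> n))) / real (n choose (\<kappa> n - 1)) else 0)"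
  \<comment> \<open>For \<open>n \<ge> N\<close> the numerator 1 suffices; for
    \<open>1 \<le> n < N\<close> the proportion of non-atoms is at most 1, hence at most
    \<open>N / n\<close>.\<close>
  define C where "C = real N + 1"
  have \<kappa>: "\<kappa> n = k" if "real k = \<epsilon> * real n" for n k
    unfolding \<kappa>_def by (simp flip: that)
  have k_bounds: "1 \<le> k" "k \<le> n" if "1 \<le> n" "real k = \<epsilon> * real n" for n k
  proof -
    have "0 < real k" "real k < real n"
      using that assms by simp_all
    then show "1 \<le> k" "k \<le> n"
      by simp_all
  qed
  have bound: "\<bar>\<gamma> n\<bar> \<le> C / real n" if "1 \<le> n" for n
  proof (cases "real (\<kappa> n) = \<epsilon> * real n")
    case True
    let ?b = "real (n choose (\<kappa> n - 1))" and ?c = "real (card (non_atoms n (\<kappa> n)))"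
    have b: "0 < ?b"
      using k_bounds[OF that True] by simp
    have "?c \<le> ?b"
      using alpha_plus_card_non_atoms[OF k_bounds(1)[OF that True], of n] by linarith
    have "real n * ?c \<le> C * ?b"
    proof (cases "N \<le> n")
      case True
      then have "real n * ?c \<le> 1 * ?b"
        using N \<open>real (\<kappa> n) = \<epsilon> * real n\<close> by simp
      also have "\<dots> \<le> C * ?b"
        unfolding C_def by (intro mult_right_mono) auto
      finally show ?thesis .
    next
      case False
      then show ?thesis
        unfolding C_def using \<open>?c \<le> ?b\<close> by (intro mult_mono) auto
    qed
    then have "?c / ?b \<le> C / real n"
      using b that by (simp add: field_simps)
    then show ?thesis
      using True that by (simp add: \<gamma>_def)
  qed (auto simp: \<gamma>_def C_def)
  have "\<gamma> \<longlonglongrightarrow> 0"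
  proof (rule tendsto_0_le[OF lim_const_over_n[of C], where K = 1])
    show "\<forall>\<^sub>F n in sequentially. norm (\<gamma> n) \<le> norm (C / real n) * 1"
      unfolding eventually_sequentially
    proof (intro exI[of _ 1] allI impI)
      fix n :: nat assume "1 \<le> n"
      then show "norm (\<gamma> n) \<le> norm (C / real n) * 1"
        using order_trans[OF bound abs_ge_self] by simp
    qed
  qed
  moreover have "real (alpha n k) = real (n choose (k - 1)) * (1 - \<gamma> n)"
    if "1 \<le> n" "real k = \<epsilon> * real n" for n k
  proof -
    have "real (alpha n k) + real (card (non_atoms n k)) = real (n choose (k - 1))"
      using alpha_plus_card_non_atoms[OF k_bounds(1)[OF that]] by (metis of_nat_add)
    moreover have "0 < real (n choose (k - 1))"
      using k_bounds[OF that] by simp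
    moreover have "\<gamma> n = real (card (non_atoms n k)) / real (n choose (k - 1))"
      using that \<kappa>[OF that(2)] by (simp add: \<gamma>_def)
    ultimately show ?thesis
      by (simp add: field_simps)
  qed
  moreover have "C > 0"
    by (simp add: C_def)
  ultimately show ?thesis
    using bound by blast
qed

end
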